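(* Let $q\ge0$ be an integer and let $K\subset\mathbb{R}^d$ be a nonempty compact convex set with $0\in K$. Then the polynomial $\epsilon\mapsto\int_{K+\epsilon B}|s|^{2q}\,ds$ (for $\epsilon\ge0$) has nonnegative coefficients.
   Context: $B$ is the Euclidean unit ball of $\mathbb{R}^d$, $|\cdot|$ the Euclidean norm, $ds$ Lebesgue measure. The function $\epsilon\mapsto\int_{K+\epsilon B}|s|^{2q}ds$ is a polynomial in $\epsilon\ge0$. *)

theory Defs
  imports "HOL-Analysis.Analysis" "HOL-Computational_Algebra.Polynomial"
begin

definition parallel_body :: "'a::euclidean_space set \<Rightarrow> real \<Rightarrow> 'a set" where
  "parallel_body K \<epsilon> = {x + \<epsilon> *\<^sub>R b | x b. x \<in> K \<and> b \<in> cball 0 1}"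

end

theory Submission
  imports Defs
begin

text \<open>
  Suppose first that \<open>K\<close> is a polytope with nearest-point map \<open>\<pi>\<close>. Space splits into the regions
  \<open>R\<^sub>F = {s. \<pi> s \<in> rel_interior F}\<close>, one for each face \<open>F\<close>. On \<open>R\<^sub>F\<close> the vector \<open>u = s - \<pi> s\<close> is orthogonal
  to \<open>F\<close>, so the map \<open>x + u \<mapsto> x + t u\<close> (with \<open>x = \<pi> s\<close>) agrees there with an affine dilation of determinant
  \<open>t\<^sup>m\<close>, where \<open>m\<close> is the codimension of \<open>F\<close>, and it carries the part of \<open>R\<^sub>F\<close> at distance at most 1 onto
  the part at distance at most \<open>t\<close>. The integrand becomes the \<open>q\<close>-th power of
  \<open>|x + t u|\<^sup>2 = |x|\<^sup>2 + 2 t \<langle>x, u\<rangle> + t\<^sup>2 |u|\<^sup>2\<close>, whose coefficients are nonnegative because \<open>0 \<in> K\<close> gives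
  \<open>\<langle>x, u\<rangle> \<ge> 0\<close>. A general \<open>K\<close> is squeezed between inner polytopes and their small parallel bodies; the
  degrees and coefficients of the polynomials stay bounded, so a subsequence converges.
\<close>

section \<open>Linear changes of variables for Lebesgue measure\<close>

text \<open>
  The image measure is translation invariant, hence by Tonelli proportional to Lebesgue measure;
  both agree on the unit ball.
\<close>

lemma lborel_orthogonal_transformation:
  fixes f :: "'a::euclidean_space \<Rightarrow> 'a"
  assumes f: "orthogonal_transformation f"
  shows "distr lborel borel f = lborel"
proof -
  define M where "M = distr lborel borel f"
  have lin: "linear f" using f by (rule orthogonal_transformation_linear)
  have cont: "continuous_on UNIV f" using lin by (simp add: linear_continuous_on linear_linear)
  have [measurable]: "f \<in> borel_measurable borel" using cont by (rule borel_measurable_continuous_onI)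
  have bij: "bij f" using f by (rule orthogonal_transformation_bij)
  have [measurable_cong, simp]: "sets M = sets borel" by (simp add: M_def)
  \<comment> \<open>As \<open>f\<close> is onto, a shift by \<open>c = f d\<close> of the image
    measure pulls back to the shift by \<open>d\<close> of Lebesgue measure.\<close>
  have transM: "(\<integral>\<^sup>+x. h (x + c) \<partial>M) = (\<integral>\<^sup>+x. h x \<partial>M)"
    if [measurable]: "h \<in> borel_measurable borel" for h :: "'a \<Rightarrow> ennreal" and c
  proof -
    obtain d where d: "c = f d" using bij by (metis bij_pointE)
    have "(\<integral>\<^sup>+x. h (x + c) \<partial>M) = (\<integral>\<^sup>+x. h (f (d + x)) \<partial>lborel)"
      unfolding M_def d by (subst nn_integral_distr) (auto simp: linear_add[OF lin] add.commute)
    also have "\<dots> = (\<integral>\<^sup>+x. h (f x) \<partial>distr lborel borel ((+) d))"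
      by (subst nn_integral_distr) auto
    also have "\<dots> = (\<integral>\<^sup>+x. h x \<partial>M)"
      unfolding lborel_distr_plus M_def by (subst nn_integral_distr) auto
    finally show ?thesis .
  qed
  have ball: "emeasure M (ball 0 r) = emeasure lborel (ball (0::'a) r)" for r
  proof -
    have "f -` ball 0 r = ball 0 r"
      using f by (auto simp: orthogonal_transformation_norm)
    then show ?thesis unfolding M_def by (subst emeasure_distr) auto
  qed
  have "sigma_finite_measure M"
  proof
    show "\<exists>A. countable A \<and> A \<subseteq> sets M \<and> \<Union> A = space M \<and> (\<forall>a\<in>A. emeasure M a \<noteq> \<infinity>)"
    proof (intro exI[of _ "range (\<lambda>n::nat. ball 0 (real n))"] conjI)
      show "\<Union> (range (\<lambda>n::nat. ball 0 (real n))) = space M"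
        by (auto simp: M_def dist_norm intro: reals_Archimedean2)
    qed (use emeasure_lborel_ball_finite[where 'a='a] in \<open>auto simp: ball less_top\<close>)
  qed
  then interpret M: sigma_finite_measure M .
  interpret pair_sigma_finite M "lborel :: 'a measure" ..
  have reflect: "(\<integral>\<^sup>+y. h (x - y) \<partial>lborel) = (\<integral>\<^sup>+y. h y \<partial>lborel)"
    if [measurable]: "h \<in> borel_measurable borel" for h :: "'a \<Rightarrow> ennreal" and x
    by (subst (2) lborel_affine[of "-1" x])
       (auto simp: nn_integral_density nn_integral_distr)
  have tr: "(\<integral>\<^sup>+y. h (x + y) \<partial>lborel) = (\<integral>\<^sup>+y. h y \<partial>lborel)"
    if [measurable]: "h \<in> borel_measurable borel" for h :: "'a \<Rightarrow> ennreal" and x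
    by (subst (2) lborel_distr_plus[of x, symmetric]) (auto simp: nn_integral_distr)
  \<comment> \<open>The double integral of the indicator of \<open>x \<in> A\<close>,
    \<open>x + y \<in> B\<close> is evaluated in two ways: \<open>y\<close> first, or after the
    shift of \<open>x\<close> by \<open>- y\<close> permitted by \<open>transM\<close>. Hence the
    ratio of the two measures does not depend on the set.\<close>
  have swap: "emeasure M A * emeasure lborel B = emeasure M B * emeasure lborel A"
    if [measurable]: "A \<in> sets borel" "B \<in> sets borel" for A B
  proof -
    have "emeasure M A * emeasure lborel B
        = (\<integral>\<^sup>+x. \<integral>\<^sup>+y. indicator A x * indicator B (x + y) \<partial>lborel \<partial>M)"
      by (simp add: nn_integral_cmult tr[of "indicator B"] nn_integral_multc)
    also have "\<dots> = (\<integral>\<^sup>+y. \<integral>\<^sup>+x. indicator A x * indicator B (x + y) \<partial>M \<partial>lborel)"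
      by (rule Fubini'[symmetric]) simp
    also have "\<dots> = (\<integral>\<^sup>+y. \<integral>\<^sup>+x. indicator A (x - y) * indicator B x \<partial>M \<partial>lborel)"
    proof (rule nn_integral_cong)
      fix y
      show "(\<integral>\<^sup>+x. indicator A x * indicator B (x + y) \<partial>M)
          = (\<integral>\<^sup>+x. indicator A (x - y) * indicator B x \<partial>M)"
        using transM[of "\<lambda>x. indicator A x * indicator B (x + y)" "- y"] by simp
    qed
    also have "\<dots> = (\<integral>\<^sup>+x. \<integral>\<^sup>+y. indicator A (x - y) * indicator B x \<partial>lborel \<partial>M)"
      by (rule Fubini') simp
    also have "\<dots> = emeasure M B * emeasure lborel A"
      by (simp add: nn_integral_multc nn_integral_cmult reflect[of "indicator A"] mult.commute)
    finally show ?thesis .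
  qed
  show ?thesis
    unfolding M_def[symmetric]
  proof (rule measure_eqI)
    fix A assume "A \<in> sets M"
    then have [measurable]: "A \<in> sets borel" by simp
    \<comment> \<open>The unit ball has positive finite measure and is preserved by
      \<open>f\<close>, so it cancels from \<open>swap\<close> and the ratio is 1.\<close>
    have pos: "emeasure lborel (ball (0::'a) 1) \<noteq> 0"
      using content_ball_pos[of 1 "0::'a"] by (auto simp: measure_def)
    show "emeasure M A = emeasure lborel A"
      using swap[of A "ball 0 1"] pos emeasure_lborel_ball_finite[of "0::'a" 1]
      by (auto simp: ball mult.commute[of _ "emeasure lborel (ball 0 1)"] ennreal_mult_cancel_left)
  qed simp
qed

text \<open>Orthonormal bases of \<open>V\<close> and of its orthogonal complement together have
  \<open>DIM('a)\<close> elements, so the standard basis can be carried onto their union. In these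
  coordinates a dilation normal to \<open>V\<close> is diagonal.\<close>

lemma orthonormal_basis_adapted_to_subspace:
  fixes V :: "'a::euclidean_space set"
  assumes V: "subspace V"
  obtains g A where "orthogonal_transformation (g :: 'a \<Rightarrow> 'a)" "A \<subseteq> Basis"
    "\<And>e. e \<in> A \<Longrightarrow> g e \<in> V"
    "\<And>e v. e \<in> Basis - A \<Longrightarrow> v \<in> V \<Longrightarrow> v \<bullet> g e = 0"
proof -
  define W where "W = {y. \<forall>x\<in>V. orthogonal x y}"
  have W: "subspace W"
    unfolding W_def using subspace_orthogonal_to_vectors by blast
  obtain B where B: "B \<subseteq> V" "pairwise orthogonal B" "\<And>x. x \<in> B \<Longrightarrow> norm x = 1"
    "independent B" "card B = dim V" "span B = V"
    using orthonormal_basis_subspace[OF V] by blast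
  obtain C where C: "C \<subseteq> W" "pairwise orthogonal C" "\<And>x. x \<in> C \<Longrightarrow> norm x = 1"
    "independent C" "card C = dim W" "span C = W"
    using orthonormal_basis_subspace[OF W] by blast
  have fin: "finite B" "finite C" using B C by (auto simp: independent_imp_finite)
  have BC: "x \<bullet> y = 0" if "x \<in> B" "y \<in> C" for x y
    using that B(1) C(1) by (auto simp: W_def orthogonal_def)
  have disj: "B \<inter> C = {}"
    using BC B(3) by (metis disjoint_iff inner_eq_zero_iff norm_zero zero_neq_one)
  have "dim W + dim V = DIM('a)"
    using dim_subspace_orthogonal_to_vectors[OF V subspace_UNIV] by (simp add: W_def)
  then have "card (B \<union> C) = card (Basis :: 'a set)"
    using B C fin disj by (simp add: card_Un_disjoint)
  then obtain h :: "'a \<Rightarrow> 'a" where h: "bij_betw h Basis (B \<union> C)"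
    using fin by (metis bij_betw_iff_card finite_Basis finite_UnI)
  have orth: "h i \<bullet> h j = (if i = j then 1 else 0)" if "i \<in> Basis" "j \<in> Basis" for i j
  proof (cases "i = j")
    case True
    have "h i \<in> B \<union> C" using h that by (auto dest: bij_betwE)
    then have "norm (h i) = 1" using B(3) C(3) by blast
    then show ?thesis using True by (simp add: dot_square_norm)
  next
    case False
    have "h i \<in> B \<union> C" "h j \<in> B \<union> C" "h i \<noteq> h j"
      using h that False by (auto dest: bij_betwE simp: bij_betw_def inj_on_def)
    then have "h i \<bullet> h j = 0"
      using B(2) C(2) BC inner_commute[of "h i" "h j"] by (auto simp: pairwise_def orthogonal_def)
    then show ?thesis using False by simp
  qed
  define g where "g x = (\<Sum>e\<in>Basis. (x \<bullet> e) *\<^sub>R h e)" for x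
  have ge: "g e = h e" if "e \<in> Basis" for e
    using that by (simp add: g_def inner_Basis if_distrib[of "\<lambda>c. c *\<^sub>R _"] cong: if_cong)
  have "linear g"
    by (auto intro!: linearI simp: g_def inner_add_left scaleR_add_left sum.distrib scaleR_sum_right)
  moreover have "g x \<bullet> g y = x \<bullet> y" for x y
  proof -
    have "g x \<bullet> g y = (\<Sum>i\<in>Basis. \<Sum>j\<in>Basis. (x \<bullet> i) * ((y \<bullet> j) * (h i \<bullet> h j)))"
      unfolding g_def inner_sum_left by (simp add: inner_sum_right sum_distrib_left mult.left_commute)
    also have "\<dots> = (\<Sum>i\<in>Basis. (x \<bullet> i) * (y \<bullet> i))"
      by (intro sum.cong refl) (simp add: orth if_distrib[of "\<lambda>c. _ * c"] cong: if_cong)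
    finally show ?thesis using euclidean_inner[of x y] by simp
  qed
  ultimately have "orthogonal_transformation g"
    by (simp add: orthogonal_transformation_def)
  moreover have "g e \<in> V" if "e \<in> Basis \<inter> h -` B" for e
    using that ge B(1) by auto
  moreover have "v \<bullet> g e = 0" if "e \<in> Basis - (Basis \<inter> h -` B)" "v \<in> V" for e v
  proof -
    have "h e \<in> C" using that h by (auto dest: bij_betwE)
    then show ?thesis using that C(1) ge by (auto simp: W_def orthogonal_def)
  qed
  ultimately show ?thesis using that[of g "Basis \<inter> h -` B"] by blast
qed

text \<open>The map \<open>T\<close> is a diagonal map conjugated by the rotation \<open>g\<close>,
  so its Jacobian is the product of the diagonal entries. The exponent \<open>m\<close> is fixed
  before \<open>t\<close>, since it must later serve as a polynomial degree; the free centre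
  \<open>a\<close> allows dilation about affine subspaces.\<close>

lemma integral_orthogonal_dilation:
  fixes V :: "'a::euclidean_space set"
  assumes V: "subspace V"
  obtains m where "m \<le> DIM('a)"
    "\<And>t. t > 0 \<Longrightarrow> \<exists>T. inj T \<and> (\<forall>v\<in>V. \<forall>w. (\<forall>x\<in>V. x \<bullet> w = 0) \<longrightarrow> T (v + w) = v + t *\<^sub>R w)
      \<and> (\<forall>a. \<forall>f :: 'a \<Rightarrow> real. f \<in> borel_measurable borel \<longrightarrow>
            integral\<^sup>L lborel f = t ^ m * (\<integral>s. f (a + T (s - a)) \<partial>lborel))"
proof -
  obtain g A where g: "orthogonal_transformation (g :: 'a \<Rightarrow> 'a)" and A: "A \<subseteq> Basis"
    and gV: "\<And>e. e \<in> A \<Longrightarrow> g e \<in> V"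
    and gW: "\<And>e v. e \<in> Basis - A \<Longrightarrow> v \<in> V \<Longrightarrow> v \<bullet> g e = 0"
    using orthonormal_basis_adapted_to_subspace[OF V] by blast
  have lin: "linear g" using g by (rule orthogonal_transformation_linear)
  have gcont: "continuous_on UNIV g" using lin by (simp add: linear_continuous_on linear_linear)
  have [measurable]: "g \<in> borel_measurable borel" using gcont by (rule borel_measurable_continuous_onI)
  have gi: "g x \<bullet> g y = x \<bullet> y" for x y using g by (simp add: orthogonal_transformation_def)
  \<comment> \<open>The vectors \<open>g e\<close> form an orthonormal basis, because
    \<open>g\<close> is onto and preserves inner products.\<close>
  have expand: "(\<Sum>e\<in>Basis. (y \<bullet> g e) *\<^sub>R g e) = y" for y
  proof -
    obtain x where x: "y = g x" using g orthogonal_transformation_surj by (metis surjD)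
    show ?thesis unfolding x gi
      by (metis (no_types, lifting) euclidean_representation lin linear_scale linear_sum sum.cong)
  qed
  show ?thesis
  proof (rule that[of "card (Basis - A)"])
    show "card (Basis - A) \<le> DIM('a)" by (simp add: card_mono)
    fix t :: real assume t: "t > 0"
    \<comment> \<open>Directions in \<open>V\<close> are kept and directions normal to
      \<open>V\<close> are stretched by \<open>t\<close>.\<close>
    define c where "c e = (if e \<in> A then 1 else t)" for e
    define D where "D x = (\<Sum>e\<in>Basis. (c e * (x \<bullet> e)) *\<^sub>R e)" for x :: 'a
    define T where "T y = (\<Sum>e\<in>Basis. (c e * (y \<bullet> g e)) *\<^sub>R g e)" for y
    have c0: "c e > 0" for e using t by (simp add: c_def)
    have [measurable]: "D \<in> borel_measurable borel" "T \<in> borel_measurable borel"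
      unfolding D_def T_def by simp_all
    have Tg: "T (g x) = g (D x)" for x
      by (simp add: T_def D_def gi linear_sum[OF lin] linear_scale[OF lin])
    have prod: "(\<Prod>e\<in>Basis. \<bar>c e\<bar>) = t ^ card (Basis - A)"
    proof -
      have "(\<Prod>e\<in>Basis. \<bar>c e\<bar>) = (\<Prod>e\<in>Basis - A. t) * (\<Prod>e\<in>A. 1)"
        using A t by (subst prod.subset_diff[OF A]) (auto simp: c_def intro!: prod.cong)
      then show ?thesis by simp
    qed
    have inj: "inj T"
    proof (rule injI)
      fix y z assume eq: "T y = T z"
      have "T x \<bullet> g e = c e * (x \<bullet> g e)" if "e \<in> Basis" for x e
        using that by (simp add: T_def inner_sum_left gi inner_Basis if_distrib[of "\<lambda>c. _ * c"] cong: if_cong)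
      then have "y \<bullet> g e = z \<bullet> g e" if "e \<in> Basis" for e
        using eq that c0[of e] by (metis less_irrefl mult_left_cancel)
      then show "y = z" by (metis (no_types, lifting) expand sum.cong)
    qed
    have split: "T (v + w) = v + t *\<^sub>R w" if v: "v \<in> V" and w: "\<forall>x\<in>V. x \<bullet> w = 0" for v w
    proof -
      have "c e * ((v + w) \<bullet> g e) = (v + t *\<^sub>R w) \<bullet> g e" if "e \<in> Basis" for e
        using that gV[of e] gW[of e v] v w
        by (cases "e \<in> A") (auto simp: c_def inner_add_left inner_commute[of w])
      then have "T (v + w) = (\<Sum>e\<in>Basis. ((v + t *\<^sub>R w) \<bullet> g e) *\<^sub>R g e)"
        unfolding T_def by (intro sum.cong) auto
      then show ?thesis by (simp only: expand)
    qed
    have int: "integral\<^sup>L lborel f = t ^ card (Basis - A) * (\<integral>s. f (a + T (s - a)) \<partial>lborel)"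
      if f[measurable]: "f \<in> borel_measurable borel" for a and f :: "'a \<Rightarrow> real"
    proof -
      \<comment> \<open>The chain translates by \<open>a\<close>, rotates by \<open>g\<close>,
        stretches by \<open>D\<close>, which gives the Jacobian, and then undoes the rotation by
        \<open>Tg\<close> and the translation.\<close>
      have "integral\<^sup>L lborel f = integral\<^sup>L (distr lborel borel ((+) a)) f"
        by (simp add: lborel_distr_plus)
      also have "\<dots> = (\<integral>s. f (a + s) \<partial>lborel)"
        by (subst integral_distr) auto
      also have "\<dots> = (\<integral>s. f (a + s) \<partial>distr lborel borel g)"
        by (simp add: lborel_orthogonal_transformation[OF g])
      also have "\<dots> = (\<integral>s. f (a + g s) \<partial>lborel)"
        by (subst integral_distr) auto
      also have "\<dots> = (\<integral>s. f (a + g s) \<partial>density (distr lborel borel D) (\<lambda>_. (\<Prod>e\<in>Basis. \<bar>c e\<bar>)))"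
        using lborel_affine_euclidean[of c 0] c0 by (simp add: D_def[abs_def] less_imp_neq[symmetric])
      also have "\<dots> = t ^ card (Basis - A) * (\<integral>s. f (a + g (D s)) \<partial>lborel)"
        using t by (subst integral_density) (auto simp: integral_distr prod)
      also have "(\<integral>s. f (a + g (D s)) \<partial>lborel) = (\<integral>s. f (a + T s) \<partial>distr lborel borel g)"
        by (subst integral_distr) (auto simp: Tg)
      also have "\<dots> = (\<integral>s. f (a + T s) \<partial>lborel)"
        by (simp add: lborel_orthogonal_transformation[OF g])
      also have "\<dots> = (\<integral>s. f (a + T s) \<partial>distr lborel borel ((+) (- a)))"
        by (simp add: lborel_distr_plus)
      also have "\<dots> = (\<integral>s. f (a + T (s - a)) \<partial>lborel)"
        by (subst integral_distr) auto
      finally show ?thesis .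
    qed
    show "\<exists>T. inj T \<and> (\<forall>v\<in>V. \<forall>w. (\<forall>x\<in>V. x \<bullet> w = 0) \<longrightarrow> T (v + w) = v + t *\<^sub>R w)
      \<and> (\<forall>a. \<forall>f :: 'a \<Rightarrow> real. f \<in> borel_measurable borel \<longrightarrow>
            integral\<^sup>L lborel f = t ^ card (Basis - A) * (\<integral>s. f (a + T (s - a)) \<partial>lborel))"
      using inj split int by (intro exI[of _ T]) blast
  qed
qed

section \<open>Nearest points and parallel bodies\<close>

text \<open>Expanding the square of \<open>norm (x + u - z)\<close> about \<open>x\<close> leaves
  \<open>norm u\<close> squared plus two nonnegative terms. This is the converse of the variational
  inequality for projections.\<close>

lemma closest_point_add_normal:
  fixes S :: "'a::euclidean_space set"
  assumes S: "convex S" "closed S" and x: "x \<in> S" and u: "\<And>y. y \<in> S \<Longrightarrow> u \<bullet> (y - x) \<le> 0"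
  shows "closest_point S (x + u) = x"
proof (rule closest_point_unique[OF S x, symmetric], rule ballI)
  fix z assume "z \<in> S"
  have "(norm (x + u - x))\<^sup>2 \<le> (norm u)\<^sup>2 + (norm (z - x))\<^sup>2 - 2 * (u \<bullet> (z - x))"
    using u[OF \<open>z \<in> S\<close>] zero_le_power2[of "norm (z - x)"] unfolding add_diff_cancel_left' by linarith
  also have "\<dots> = (norm (x + u - z))\<^sup>2"
    unfolding power2_norm_eq_inner by (simp add: algebra_simps inner_commute)
  finally show "dist (x + u) x \<le> dist (x + u) z"
    by (simp add: dist_norm)
qed

lemma parallel_body_eq:
  fixes K :: "'a::euclidean_space set"
  assumes \<epsilon>: "\<epsilon> \<ge> 0"
  shows "parallel_body K \<epsilon> = {s. \<exists>x\<in>K. norm (s - x) \<le> \<epsilon>}"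
proof (intro set_eqI iffI)
  fix s assume "s \<in> parallel_body K \<epsilon>"
  then show "s \<in> {s. \<exists>x\<in>K. norm (s - x) \<le> \<epsilon>}"
    using \<epsilon> by (force simp: parallel_body_def mult_left_le)
next
  fix s assume "s \<in> {s. \<exists>x\<in>K. norm (s - x) \<le> \<epsilon>}"
  then obtain x where s: "x \<in> K" "norm (s - x) \<le> \<epsilon>" by blast
  \<comment> \<open>For \<open>\<epsilon> = 0\<close> division by zero gives \<open>b = 0\<close>,
    which is the right choice because then \<open>s = x\<close>.\<close>
  define b where "b = (1 / \<epsilon>) *\<^sub>R (s - x)"
  have "s = x + \<epsilon> *\<^sub>R b"
    using s by (cases "\<epsilon> = 0") (simp_all add: b_def)
  moreover have "norm b \<le> 1"
    using s \<epsilon> by (cases "\<epsilon> = 0") (simp_all add: b_def)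
  ultimately show "s \<in> parallel_body K \<epsilon>"
    unfolding parallel_body_def using s by force
qed

lemma parallel_body_eq_closest_point:
  fixes K :: "'a::euclidean_space set"
  assumes K: "closed K" "K \<noteq> {}" and \<epsilon>: "\<epsilon> \<ge> 0"
  shows "parallel_body K \<epsilon> = {s. norm (s - closest_point K s) \<le> \<epsilon>}"
  unfolding parallel_body_eq[OF \<epsilon>]
  using closest_point_in_set[OF K] closest_point_le[OF K(1)]
  by (fastforce simp: dist_norm intro: order_trans)

lemma parallel_body_mono:
  assumes "K \<subseteq> L" "0 \<le> \<epsilon>" "\<epsilon> \<le> \<delta>"
  shows "parallel_body K \<epsilon> \<subseteq> parallel_body L \<delta>"
  using assms parallel_body_eq[of \<epsilon> K] parallel_body_eq[of \<delta> L] by fastforce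

lemma parallel_body_add:
  assumes "K \<subseteq> parallel_body L \<delta>" "0 \<le> \<epsilon>" "0 \<le> \<delta>"
  shows "parallel_body K \<epsilon> \<subseteq> parallel_body L (\<epsilon> + \<delta>)"
proof
  fix s assume "s \<in> parallel_body K \<epsilon>"
  then obtain x where x: "x \<in> K" "norm (s - x) \<le> \<epsilon>" using assms by (auto simp: parallel_body_eq)
  then obtain y where y: "y \<in> L" "norm (x - y) \<le> \<delta>" using assms by (auto simp: parallel_body_eq)
  have "norm (s - y) \<le> \<epsilon> + \<delta>"
    using norm_triangle_mono[OF x(2) y(2)] by simp
  then show "s \<in> parallel_body L (\<epsilon> + \<delta>)" using y assms by (auto simp: parallel_body_eq)
qed

lemma compact_parallel_body:
  assumes "compact K"
  shows "compact (parallel_body K \<epsilon>)"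
proof -
  have "parallel_body K \<epsilon> = {x + y | x y. x \<in> K \<and> y \<in> (*\<^sub>R) \<epsilon> ` cball 0 1}"
    unfolding parallel_body_def by blast
  then show ?thesis
    by (simp only:) (rule compact_sums[OF assms compact_scaling[OF compact_cball]])
qed

section \<open>Partition of a polytope by the relative interiors of its faces\<close>

text \<open>A face of least dimension through \<open>x\<close> must have \<open>x\<close> in its
  relative interior, as otherwise \<open>x\<close> would lie on a proper face of it. Distinct faces
  have disjoint relative interiors.\<close>

lemma polytope_rel_interior_faces:
  fixes P :: "'a::euclidean_space set"
  assumes P: "polytope P" and x: "x \<in> P"
  shows "\<exists>!F. F face_of P \<and> x \<in> rel_interior F"
proof -
  \<comment> \<open>\<open>aff_dim\<close> is integer valued and at least -1, so adding 1 makes the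
    passage to \<open>nat\<close> faithful and \<open>LEAST\<close> applicable.\<close>
  define n where "n = (LEAST n. \<exists>F. F face_of P \<and> x \<in> F \<and> nat (aff_dim F + 1) = n)"
  have "P face_of P" using P by (simp add: face_of_refl polytope_imp_convex)
  then have "\<exists>n F. F face_of P \<and> x \<in> F \<and> nat (aff_dim F + 1) = n"
    using x by blast
  then have "\<exists>F. F face_of P \<and> x \<in> F \<and> nat (aff_dim F + 1) = n"
    unfolding n_def by (rule LeastI_ex)
  then obtain F where F: "F face_of P" "x \<in> F" "nat (aff_dim F + 1) = n" by blast
  have FP: "polytope F" using F P face_of_polytope_polytope by blast
  have "x \<in> rel_interior F"
  proof (rule ccontr)
    assume "x \<notin> rel_interior F"
    then have "x \<in> rel_frontier F" using F(2) closure_subset by (auto simp: rel_frontier_def)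
    then obtain G where G: "G face_of F" "G \<noteq> F" "x \<in> G"
      using FP by (auto simp: rel_frontier_of_polyhedron_alt polytope_imp_polyhedron)
    have lt: "aff_dim G < aff_dim F"
      using G FP by (intro face_of_aff_dim_lt polytope_imp_convex)
    have "n \<le> nat (aff_dim G + 1)"
      unfolding n_def by (rule Least_le) (use G F face_of_trans in blast)
    then show False using lt F(3) aff_dim_geq[of G] by linarith
  qed
  then show ?thesis using F face_of_eq by (metis disjoint_iff)
qed

section \<open>Coefficients of powers of polynomials\<close>

lemma norm_add_scaleR_power2:
  fixes x u :: "'a::real_inner"
  shows "(norm (x + t *\<^sub>R u))\<^sup>2 = (norm x)\<^sup>2 + 2 * t * (x \<bullet> u) + t\<^sup>2 * (norm u)\<^sup>2"
  unfolding power2_norm_eq_inner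
  by (simp add: inner_add_left inner_add_right inner_commute[of u x] power2_eq_square distrib_left)

lemma coeff_power_nonneg:
  fixes p :: "real poly"
  assumes "\<And>i. coeff p i \<ge> 0"
  shows "coeff (p ^ n) i \<ge> 0"
proof (induction n arbitrary: i)
  case 0
  then show ?case by (simp add: coeff_1)
next
  case (Suc n)
  then show ?case by (simp add: coeff_mult sum_nonneg assms)
qed

lemma continuous_on_coeff_power:
  fixes p :: "'a::topological_space \<Rightarrow> real poly"
  assumes "\<And>i. continuous_on S (\<lambda>s. coeff (p s) i)"
  shows "continuous_on S (\<lambda>s. coeff (p s ^ n) i)"
proof (induction n arbitrary: i)
  case (Suc n)
  then show ?case by (auto simp: coeff_mult intro!: continuous_intros assms)
qed simp

lemma poly_altdef_le:
  fixes p :: "real poly"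
  assumes "degree p \<le> n"
  shows "poly p x = (\<Sum>i\<le>n. coeff p i * x ^ i)"
  unfolding poly_altdef
  by (rule sum.mono_neutral_left) (use assms in \<open>auto simp: coeff_eq_0\<close>)

section \<open>The integral for a polytope, one face region at a time\<close>

text \<open>A relative interior is an open set intersected with a closed affine hull, and the
  projection is continuous.\<close>

lemma borel_closest_point_region:
  fixes S F :: "'a::euclidean_space set"
  assumes "convex S" "closed S" "S \<noteq> {}"
  shows "closest_point S -` rel_interior F \<in> sets borel"
proof -
  have "closest_point S \<in> borel_measurable borel"
    using assms by (intro borel_measurable_continuous_onI continuous_on_closest_point)
  moreover obtain U where "open U" "rel_interior F = affine hull F \<inter> U"
    using openin_rel_interior[of F] by (auto simp: openin_open)
  then have "rel_interior F \<in> sets borel"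
    by (simp add: borel_closed sets.Int)
  ultimately show ?thesis
    using measurable_sets[of "closest_point S" borel borel "rel_interior F"] by simp
qed

text \<open>After the dilation the domain no longer depends on \<open>t\<close>: only the Jacobian
  \<open>t ^ m\<close> and the polynomial integrand do. Integrating the coefficients over the fixed
  layer at distance at most 1 yields \<open>p\<close>. The degree bound is the same for all
  polytopes, as the later limit requires.\<close>

lemma polytope_region_integral:
  fixes P F :: "'a::euclidean_space set"
  assumes P: "polytope P" and P0: "0 \<in> P" and F: "F face_of P"
  defines "R \<equiv> closest_point P -` rel_interior F"
  shows "\<exists>p :: real poly. degree p \<le> DIM('a) + 2 * q \<and> (\<forall>i. coeff p i \<ge> 0) \<and>
    (\<forall>t>0. (\<integral>s. indicator (R \<inter> parallel_body P t) s * norm s ^ (2 * q) \<partial>lborel) = poly p t)"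
proof (cases "F = {}")
  case True
  then show ?thesis by (intro exI[of _ 0]) (simp add: R_def)
next
  case False
  then obtain a where a: "a \<in> F" by blast
  have cP: "convex P" "closed P" "P \<noteq> {}" "compact P"
    using P P0 by (auto simp: polytope_imp_convex polytope_imp_closed polytope_imp_compact)
  have FP: "F \<subseteq> P" and cF: "convex F" using F by (auto simp: face_of_imp_subset face_of_imp_convex)
  define \<pi> where "\<pi> = closest_point P"
  \<comment> \<open>This is the direction space of the affine hull of \<open>F\<close>.\<close>
  define V where "V = span ((\<lambda>x. x - a) ` F)"
  have V: "subspace V" by (simp add: V_def)
  have \<pi>P: "\<pi> s \<in> P" for s using cP by (simp add: \<pi>_def closest_point_in_set)
  have dot: "(s - \<pi> s) \<bullet> (y - \<pi> s) \<le> 0" if "y \<in> P" for s y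
    unfolding \<pi>_def using cP that by (simp add: closest_point_dot)
  have \<pi>_ray: "\<pi> (\<pi> s + t *\<^sub>R (s - \<pi> s)) = \<pi> s" if "t \<ge> 0" for s t
    unfolding \<pi>_def[symmetric]
    using closest_point_add_normal[OF cP(1,2) \<pi>P, of "t *\<^sub>R (s - \<pi> s)" s] dot that
    by (simp add: \<pi>_def mult_nonneg_nonpos)
  have contpi: "continuous_on UNIV \<pi>"
    unfolding \<pi>_def using cP by (simp add: continuous_on_closest_point)
  have Rmeas: "R \<in> sets borel"
    unfolding R_def using cP by (intro borel_closest_point_region)
  have E: "parallel_body P t = {s. norm (s - \<pi> s) \<le> t}" if "t \<ge> 0" for t
    unfolding \<pi>_def using parallel_body_eq_closest_point cP that by blast
  have Emeas: "parallel_body P t \<in> sets borel" for t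
    using compact_parallel_body[OF cP(4)] by (simp add: borel_compact)
  have xV: "\<pi> s - a \<in> V" if "s \<in> R" for s
    using that rel_interior_subset[of F] unfolding V_def R_def \<pi>_def by (auto intro!: span_base)
  \<comment> \<open>From a relative interior point one can move slightly beyond
    \<open>\<pi> s\<close>, away from any \<open>y\<close> in \<open>F\<close>, and stay in
    \<open>F\<close>. The variational inequality at that point has the opposite sign, so equality
    holds on \<open>F\<close> and extends to the span.\<close>
  have uV: "v \<bullet> (s - \<pi> s) = 0" if s: "s \<in> R" and v: "v \<in> V" for s v
  proof -
    have ri: "\<pi> s \<in> rel_interior F" using s by (simp add: R_def \<pi>_def)
    have z: "(s - \<pi> s) \<bullet> (y - \<pi> s) = 0" if y: "y \<in> F" for y
    proof -
      obtain e where e: "e > 1" "(1 - e) *\<^sub>R y + e *\<^sub>R \<pi> s \<in> F"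
        using convex_rel_interior_iff[OF cF False] ri y by blast
      have "(s - \<pi> s) \<bullet> ((1 - e) *\<^sub>R y + e *\<^sub>R \<pi> s - \<pi> s) \<le> 0"
        using dot e FP by blast
      also have "(1 - e) *\<^sub>R y + e *\<^sub>R \<pi> s - \<pi> s = (1 - e) *\<^sub>R (y - \<pi> s)"
        by (simp add: algebra_simps)
      finally have "(s - \<pi> s) \<bullet> (y - \<pi> s) \<ge> 0"
        using e by (simp add: mult_le_0_iff)
      then show ?thesis using dot[of y s] y FP by force
    qed
    have "orthogonal (s - \<pi> s) v"
    proof (rule orthogonal_to_span[OF v[unfolded V_def]])
      fix w assume "w \<in> (\<lambda>x. x - a) ` F"
      then obtain y where y: "y \<in> F" "w = y - a" by blast
      have "w = (y - \<pi> s) - (a - \<pi> s)" using y by simp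
      then show "orthogonal (s - \<pi> s) w"
        using z[OF y(1)] z[OF a] by (simp only: orthogonal_def inner_diff_right)
    qed
    then show ?thesis by (simp add: orthogonal_def inner_commute)
  qed
  define c where "c s = [:(norm (\<pi> s))\<^sup>2, 2 * (\<pi> s \<bullet> (s - \<pi> s)), (norm (s - \<pi> s))\<^sup>2:]" for s
  have c_eval: "norm (\<pi> s + t *\<^sub>R (s - \<pi> s)) ^ (2 * q) = poly (c s ^ q) t" for s t
    unfolding power_mult poly_power
    by (rule arg_cong[where f="\<lambda>x. x ^ q"])
      (unfold norm_add_scaleR_power2, simp add: c_def distrib_left mult_ac power2_eq_square)
  \<comment> \<open>Only the middle coefficient of \<open>c s\<close> is in question;
    \<open>dot\<close> at the point \<open>0\<close> of \<open>P\<close> shows that it is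
    nonnegative.\<close>
  have c_nonneg: "coeff (c s ^ q) i \<ge> 0" for s i
  proof (rule coeff_power_nonneg)
    fix i show "coeff (c s) i \<ge> 0"
      using dot[OF P0, of s]
      by (auto simp: c_def coeff_pCons inner_commute split: nat.split)
  qed
  have c_deg: "degree (c s ^ q) \<le> 2 * q" for s
  proof -
    have "degree (c s) \<le> 2" by (simp add: c_def)
    then show ?thesis using degree_power_le[of "c s" q] by (meson le_trans mult_le_mono1)
  qed
  have c_cont: "continuous_on S (\<lambda>s. coeff (c s ^ q) i)" for S i
  proof (rule continuous_on_coeff_power)
    fix i show "continuous_on S (\<lambda>s. coeff (c s) i)"
      using continuous_on_subset[OF contpi, of S]
      by (cases i; cases "i - 1"; cases "i - 2")
        (auto simp: c_def coeff_pCons intro!: continuous_intros split: nat.splits)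
  qed
  let ?I = "\<lambda>s. indicator (R \<inter> parallel_body P 1) s :: real"
  \<comment> \<open>Each coefficient is continuous in \<open>s\<close>, hence integrable on the
    compact parallel body, and \<open>R\<close> is Borel.\<close>
  have int: "integrable lborel (\<lambda>s. ?I s * coeff (c s ^ q) i)" for i
  proof -
    have "integrable lborel (\<lambda>s. indicator R s *\<^sub>R (indicator (parallel_body P 1) s *\<^sub>R coeff (c s ^ q) i))"
      using Rmeas compact_parallel_body[OF cP(4)] c_cont
      by (intro integrable_mult_indicator borel_integrable_compact) auto
    then show ?thesis by (simp add: indicator_inter_arith mult.assoc)
  qed
  obtain m where m: "m \<le> DIM('a)" and T:
    "\<And>t. t > 0 \<Longrightarrow> \<exists>T. inj T \<and> (\<forall>v\<in>V. \<forall>w. (\<forall>x\<in>V. x \<bullet> w = 0) \<longrightarrow> T (v + w) = v + t *\<^sub>R w)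
      \<and> (\<forall>a. \<forall>f :: 'a \<Rightarrow> real. f \<in> borel_measurable borel \<longrightarrow>
            integral\<^sup>L lborel f = t ^ m * (\<integral>s. f (a + T (s - a)) \<partial>lborel))"
    using integral_orthogonal_dilation[OF V] by blast
  define C where "C i = (\<integral>s. ?I s * coeff (c s ^ q) i \<partial>lborel)" for i
  define p where "p = (\<Sum>i\<le>2 * q. monom (C i) (m + i))"
  have C: "C i \<ge> 0" for i unfolding C_def using c_nonneg by (intro Bochner_Integration.integral_nonneg) auto
  have "degree p \<le> DIM('a) + 2 * q"
    unfolding p_def using m by (intro degree_sum_le) (auto intro: order_trans[OF degree_monom_le])
  moreover have "coeff p i \<ge> 0" for i
    unfolding p_def using C by (auto simp: coeff_sum intro!: sum_nonneg)
  moreover have "(\<integral>s. indicator (R \<inter> parallel_body P t) s * norm s ^ (2 * q) \<partial>lborel) = poly p t"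
    if t: "t > 0" for t
  proof -
    obtain T where inj: "inj T"
      and split: "\<And>v w. v \<in> V \<Longrightarrow> (\<forall>x\<in>V. x \<bullet> w = 0) \<Longrightarrow> T (v + w) = v + t *\<^sub>R w"
      and cov: "\<And>a f. f \<in> borel_measurable borel \<Longrightarrow>
            integral\<^sup>L lborel f = t ^ m * (\<integral>s. f (a + T (s - a)) \<partial>lborel)"
      using T[OF t] by blast
    \<comment> \<open>Recentred at \<open>a\<close>, the dilation fixes the affine hull of
      \<open>F\<close> and multiplies normal vectors by \<open>t\<close>.\<close>
    define A where "A s = a + T (s - a)" for s
    have A: "A (\<pi> s + r *\<^sub>R (s - \<pi> s)) = \<pi> s + (t * r) *\<^sub>R (s - \<pi> s)" if "s \<in> R" for s r
    proof -
      have "T ((\<pi> s - a) + r *\<^sub>R (s - \<pi> s)) = (\<pi> s - a) + t *\<^sub>R (r *\<^sub>R (s - \<pi> s))"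
        using that by (intro split xV) (auto simp: uV)
      moreover have "\<pi> s + r *\<^sub>R (s - \<pi> s) - a = (\<pi> s - a) + r *\<^sub>R (s - \<pi> s)" by simp
      ultimately show ?thesis unfolding A_def by (simp only:) simp
    qed
    \<comment> \<open>Moving along the ray from \<open>\<pi> s\<close> keeps the nearest point,
      hence the region, and multiplies the distance by \<open>r\<close>.\<close>
    have mem: "\<pi> s + r *\<^sub>R (s - \<pi> s) \<in> R \<inter> parallel_body P (r * t')"
      if "s \<in> R \<inter> parallel_body P t'" "r \<ge> 0" "t' \<ge> 0" for s r t'
      using that \<pi>_ray[OF that(2), of s] by (auto simp: E R_def \<pi>_def[symmetric] mult_left_mono)
    have eq: "indicator (R \<inter> parallel_body P t) (A s) * norm (A s) ^ (2 * q)
        = ?I s * poly (c s ^ q) t" for s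
    proof (cases "s \<in> R \<inter> parallel_body P 1")
      case True
      then have "A s = \<pi> s + t *\<^sub>R (s - \<pi> s)" using A[of s 1] by simp
      then show ?thesis using mem[OF True, of t] t True c_eval[of s t] by simp
    next
      case False
      have "A s \<notin> R \<inter> parallel_body P t"
      proof
        assume As: "A s \<in> R \<inter> parallel_body P t"
        define s' where "s' = \<pi> (A s) + (1 / t) *\<^sub>R (A s - \<pi> (A s))"
        have "A s' = A s" using A[of "A s" "1 / t"] As t by (simp add: s'_def)
        then have "s' = s" using inj by (simp add: A_def inj_eq)
        moreover have "s' \<in> R \<inter> parallel_body P 1"
          using mem[OF As, of "1 / t"] t by (simp add: s'_def)
        ultimately show False using False by simp
      qed
      then show ?thesis using False by simp
    qed
    have "(\<lambda>s. indicator (R \<inter> parallel_body P t) s * norm s ^ (2 * q) :: real) \<in> borel_measurable borel"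
      using Rmeas Emeas by measurable
    from cov[OF this, of a]
    have "(\<integral>s. indicator (R \<inter> parallel_body P t) s * norm s ^ (2 * q) \<partial>lborel)
        = t ^ m * (\<integral>s. ?I s * poly (c s ^ q) t \<partial>lborel)"
      by (simp only: A_def[symmetric] eq)
    also have "\<dots> = t ^ m * (\<integral>s. (\<Sum>i\<le>2 * q. ?I s * coeff (c s ^ q) i * t ^ i) \<partial>lborel)"
      by (simp only: poly_altdef_le[OF c_deg] sum_distrib_left mult.assoc)
    also have "\<dots> = t ^ m * (\<Sum>i\<le>2 * q. C i * t ^ i)"
      using int by (subst Bochner_Integration.integral_sum) (auto simp: C_def)
    also have "\<dots> = poly p t"
      by (simp add: p_def poly_sum poly_monom sum_distrib_left power_add mult_ac)
    finally show ?thesis .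
  qed
  ultimately show ?thesis by blast
qed

text \<open>Bridge between the gauge integral of the theorem and the Lebesgue integral, in which the
  changes of variables are done.\<close>

lemma parallel_body_integral:
  fixes K :: "'a::euclidean_space set"
  assumes "compact K"
  shows "(\<lambda>s. norm s ^ n) integrable_on parallel_body K \<epsilon>"
    and "integral (parallel_body K \<epsilon>) (\<lambda>s. norm s ^ n)
       = (\<integral>s. indicator (parallel_body K \<epsilon>) s * norm s ^ n \<partial>lborel)"
    and "integrable lborel (\<lambda>s. indicator (parallel_body K \<epsilon>) s * norm s ^ n)"
proof -
  have *: "set_integrable lborel (parallel_body K \<epsilon>) (\<lambda>s. norm s ^ n)"
    unfolding set_integrable_def
    by (intro borel_integrable_compact compact_parallel_body assms continuous_intros)
  then show "(\<lambda>s. norm s ^ n) integrable_on parallel_body K \<epsilon>"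
    "integral (parallel_body K \<epsilon>) (\<lambda>s. norm s ^ n)
       = (\<integral>s. indicator (parallel_body K \<epsilon>) s * norm s ^ n \<partial>lborel)"
    using set_borel_integral_eq_integral[OF *] by (simp_all add: set_lebesgue_integral_def)
  show "integrable lborel (\<lambda>s. indicator (parallel_body K \<epsilon>) s * norm s ^ n)"
    using * by (simp add: set_integrable_def)
qed

lemma parallel_body_integral_mono:
  fixes K :: "'a::euclidean_space set"
  assumes "compact K" "compact L" "parallel_body K \<epsilon> \<subseteq> parallel_body L \<delta>"
  shows "integral (parallel_body K \<epsilon>) (\<lambda>s. norm s ^ n) \<le> integral (parallel_body L \<delta>) (\<lambda>s. norm s ^ n)"
  using assms by (intro integral_subset_le parallel_body_integral) auto

lemma polytope_parallel_body_integral: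
  fixes P :: "'a::euclidean_space set"
  assumes P: "polytope P" and P0: "0 \<in> P"
  shows "\<exists>p :: real poly. degree p \<le> DIM('a) + 2 * q \<and> (\<forall>i. coeff p i \<ge> 0) \<and>
    (\<forall>t>0. integral (parallel_body P t) (\<lambda>s. norm s ^ (2 * q)) = poly p t)"
proof -
  have cP: "closed P" "P \<noteq> {}" "compact P"
    using P P0 by (auto simp: polytope_imp_closed polytope_imp_compact)
  define R where "R F = closest_point P -` rel_interior F" for F
  have "\<forall>F\<in>{F. F face_of P}. \<exists>p :: real poly. degree p \<le> DIM('a) + 2 * q \<and> (\<forall>i. coeff p i \<ge> 0) \<and>
    (\<forall>t>0. (\<integral>s. indicator (R F \<inter> parallel_body P t) s * norm s ^ (2 * q) \<partial>lborel) = poly p t)"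
    using polytope_region_integral[OF P P0] unfolding R_def by blast
  then obtain p :: "'a set \<Rightarrow> real poly" where
    p: "\<And>F. F face_of P \<Longrightarrow> degree (p F) \<le> DIM('a) + 2 * q"
       "\<And>F i. F face_of P \<Longrightarrow> coeff (p F) i \<ge> 0"
       "\<And>F t. F face_of P \<Longrightarrow> t > 0 \<Longrightarrow>
          (\<integral>s. indicator (R F \<inter> parallel_body P t) s * norm s ^ (2 * q) \<partial>lborel) = poly (p F) t"
    unfolding bchoice_iff by auto
  have fin: "finite {F. F face_of P}" using P by (rule finite_polytope_faces)
  have "integral (parallel_body P t) (\<lambda>s. norm s ^ (2 * q)) = poly (\<Sum>F | F face_of P. p F) t"
    if t: "t > 0" for t
  proof -
    let ?E = "parallel_body P t"
    \<comment> \<open>The nearest point of \<open>s\<close> lies in the relative interior of exactly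
      one face, so the regions partition space.\<close>
    have one: "(\<Sum>F | F face_of P. indicator (R F) s :: real) = 1" for s
    proof -
      have "closest_point P s \<in> P" using cP by (simp add: closest_point_in_set)
      from polytope_rel_interior_faces[OF P this]
      obtain G where G: "G face_of P" "closest_point P s \<in> rel_interior G"
        "\<And>F. F face_of P \<Longrightarrow> closest_point P s \<in> rel_interior F \<Longrightarrow> F = G"
        by (elim ex1E) metis
      have "indicator (R F) s = (if F = G then 1 else 0 :: real)" if "F face_of P" for F
      proof (cases "F = G")
        case False
        then have "s \<notin> R F" using G(3)[OF that] unfolding R_def vimage_def by blast
        then show ?thesis using False by simp
      qed (use G(2) in \<open>simp add: R_def\<close>)
      then have "(\<Sum>F | F face_of P. indicator (R F) s :: real) = (\<Sum>F | F face_of P. if F = G then 1 else 0)"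
        by (intro sum.cong) auto
      also have "\<dots> = 1" using fin G(1) by simp
      finally show ?thesis .
    qed
    have Rmeas: "R F \<in> sets borel" for F
      unfolding R_def using cP P by (intro borel_closest_point_region polytope_imp_convex)
    have int: "integrable lborel (\<lambda>s. indicator (R F \<inter> ?E) s * norm s ^ (2 * q))" for F
      using integrable_mult_indicator[OF _ parallel_body_integral(3)[OF cP(3)], of "R F"] Rmeas
      by (simp add: indicator_inter_arith mult.assoc)
    have "integral ?E (\<lambda>s. norm s ^ (2 * q)) = (\<integral>s. indicator ?E s * norm s ^ (2 * q) \<partial>lborel)"
      using cP by (simp add: parallel_body_integral(2))
    also have "\<dots> = (\<integral>s. (\<Sum>F | F face_of P. indicator (R F \<inter> ?E) s * norm s ^ (2 * q)) \<partial>lborel)"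
      by (simp add: indicator_inter_arith mult.assoc sum_distrib_right[symmetric] one)
    also have "\<dots> = (\<Sum>F | F face_of P. poly (p F) t)"
      using int p(3) t by (subst Bochner_Integration.integral_sum) auto
    finally show ?thesis by (simp add: poly_sum)
  qed
  moreover have "degree (\<Sum>F | F face_of P. p F) \<le> DIM('a) + 2 * q"
    using fin p(1) by (intro degree_sum_le) auto
  moreover have "coeff (\<Sum>F | F face_of P. p F) i \<ge> 0" for i
    using p(2) by (auto simp: coeff_sum intro!: sum_nonneg)
  ultimately show ?thesis by blast
qed

section \<open>Approximation by polytopes and passage to the limit\<close>

text \<open>The convex hull of a finite \<open>\<delta>\<close>-net of \<open>K\<close> suffices;
  adjoining \<open>x\<close> keeps a prescribed point, later the origin, inside every
  approximant.\<close>

lemma inner_polytope_approximation: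
  fixes K :: "'a::euclidean_space set"
  assumes K: "compact K" "convex K" "x \<in> K" and \<delta>: "\<delta> > 0"
  obtains P where "polytope P" "x \<in> P" "P \<subseteq> K" "K \<subseteq> parallel_body P \<delta>"
proof -
  obtain X where X: "finite X" "X \<subseteq> K" "K \<subseteq> (\<Union>x\<in>X. ball x \<delta>)"
    using seq_compact_imp_totally_bounded[of K] K(1) \<delta> by (auto simp: compact_eq_seq_compact_metric)
  define P where "P = convex hull (insert x X)"
  have "polytope P" unfolding polytope_def P_def using X(1) by blast
  moreover have "P \<subseteq> K" unfolding P_def using K X by (intro hull_minimal) auto
  moreover have "insert x X \<subseteq> P" unfolding P_def by (rule hull_subset)
  moreover from this have "K \<subseteq> parallel_body P \<delta>"
    using X(3) \<delta> unfolding parallel_body_eq[OF less_imp_le[OF \<delta>]]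
    by (force simp: dist_norm norm_minus_commute dest!: subsetD)
  ultimately show ?thesis using that by blast
qed

text \<open>Bolzano-Weierstrass is applied to one index at a time; each refinement preserves the
  limits already obtained.\<close>

lemma finite_family_convergent_subsequence:
  fixes a :: "nat \<Rightarrow> nat \<Rightarrow> real"
  assumes "\<And>i. bounded (range (\<lambda>n. a n i))"
  shows "\<exists>r l. strict_mono (r :: nat \<Rightarrow> nat) \<and> (\<forall>i<N. (\<lambda>n. a (r n) i) \<longlonglongrightarrow> l i)"
proof (induction N)
  case 0
  show ?case using strict_mono_id by auto
next
  case (Suc N)
  then obtain r l where r: "strict_mono r" "\<forall>i<N. (\<lambda>n. a (r n) i) \<longlonglongrightarrow> l i" by blast
  have "bounded (range (\<lambda>n. a (r n) N))"
    using assms[of N] by (rule bounded_subset) auto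
  then obtain m s where s: "strict_mono s" "((\<lambda>n. a (r n) N) \<circ> s) \<longlonglongrightarrow> m"
    using bounded_imp_convergent_subsequence by blast
  have "(\<lambda>n. a (r (s n)) i) \<longlonglongrightarrow> (l(N := m)) i" if "i < Suc N" for i
  proof (cases "i = N")
    case True
    then show ?thesis using s by (simp add: o_def)
  next
    case False
    then show ?thesis using LIMSEQ_subseq_LIMSEQ[OF _ s(1), of "\<lambda>n. a (r n) i"] r that
      by (simp add: o_def)
  qed
  moreover have "strict_mono (r \<circ> s)" using r s by (simp add: strict_mono_o)
  ultimately show ?case by (intro exI[of _ "r \<circ> s"] exI[of _ "l(N := m)"]) (simp add: o_def)
qed

text \<open>This supplies the value at \<open>\<epsilon> = 0\<close>, since the polytope formula is
  proved for positive radii. Convergence is dominated by the integrand on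
  \<open>parallel_body K 1\<close>.\<close>

lemma parallel_body_integral_tendsto_0:
  fixes K :: "'a::euclidean_space set"
  assumes K: "compact K" "K \<noteq> {}"
  shows "(\<lambda>n. integral (parallel_body K (1 / real (Suc n))) (\<lambda>s. norm s ^ k))
    \<longlonglongrightarrow> integral (parallel_body K 0) (\<lambda>s. norm s ^ k)"
  unfolding parallel_body_integral(2)[OF K(1)]
proof (rule integral_dominated_convergence[where w = "\<lambda>s. indicator (parallel_body K 1) s * norm s ^ k"])
  have clK: "closed K" using K by (simp add: compact_imp_closed)
  have B: "parallel_body K \<epsilon> \<in> sets lborel" for \<epsilon>
    using compact_parallel_body[OF K(1)] by (simp add: borel_compact)
  show "(\<lambda>s. indicator (parallel_body K 0) s * norm s ^ k) \<in> borel_measurable lborel"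
    "\<And>n. (\<lambda>s. indicator (parallel_body K (1 / real (Suc n))) s * norm s ^ k) \<in> borel_measurable lborel"
    using B by measurable
  show "integrable lborel (\<lambda>s. indicator (parallel_body K 1) s * norm s ^ k)"
    using K parallel_body_integral(3) by blast
  show "AE s in lborel. norm (indicator (parallel_body K (1 / real (Suc n))) s * norm s ^ k)
      \<le> indicator (parallel_body K 1) s * norm s ^ k" for n
  proof (rule AE_I2)
    fix s
    have "parallel_body K (1 / real (Suc n)) \<subseteq> parallel_body K 1"
      by (rule parallel_body_mono) auto
    then show "norm (indicator (parallel_body K (1 / real (Suc n))) s * norm s ^ k)
      \<le> indicator (parallel_body K 1) s * norm s ^ k"
      by (auto simp: indicator_def)
  qed
  show "AE s in lborel. (\<lambda>n. indicator (parallel_body K (1 / real (Suc n))) s * norm s ^ k)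
      \<longlonglongrightarrow> indicator (parallel_body K 0) s * norm s ^ k"
  proof (rule AE_I2)
    fix s
    define d where "d = norm (s - closest_point K s)"
    have mem: "s \<in> parallel_body K \<epsilon> \<longleftrightarrow> d \<le> \<epsilon>" if "\<epsilon> \<ge> 0" for \<epsilon>
      using parallel_body_eq_closest_point[OF clK K(2) that] by (simp add: d_def)
    \<comment> \<open>At a fixed \<open>s\<close> the indicators are eventually constant: either
      \<open>d = 0\<close>, or the radius finally drops below \<open>d\<close>.\<close>
    have "eventually (\<lambda>n. d \<le> 1 / real (Suc n) \<longleftrightarrow> d \<le> 0) sequentially"
    proof (cases "d \<le> 0")
      case True
      then show ?thesis by (auto intro!: always_eventually order_trans[OF True])
    next
      case False
      then have "eventually (\<lambda>n. 1 / real (Suc n) < d) sequentially"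
        using LIMSEQ_inverse_real_of_nat order_tendstoD(2)[of _ 0 sequentially d]
        by (simp add: inverse_eq_divide)
      then show ?thesis by eventually_elim (use False in auto)
    qed
    then have "eventually (\<lambda>n. indicator (parallel_body K (1 / real (Suc n))) s * norm s ^ k
        = indicator (parallel_body K 0) s * norm s ^ k) sequentially"
      by eventually_elim (simp add: indicator_def mem)
    then show "(\<lambda>n. indicator (parallel_body K (1 / real (Suc n))) s * norm s ^ k)
      \<longlonglongrightarrow> indicator (parallel_body K 0) s * norm s ^ k"
      by (rule tendsto_eventually)
  qed
qed

theorem theorem6p1:
  fixes K :: "'a::euclidean_space set" and q :: nat
  assumes "compact K" and "convex K" and "K \<noteq> {}" and "0 \<in> K"
  shows "\<exists>p :: real poly.
           (\<forall>\<epsilon>\<ge>0. integral (parallel_body K \<epsilon>) (\<lambda>s. norm s ^ (2 * q)) = poly p \<epsilon>)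
         \<and> (\<forall>i. coeff p i \<ge> 0)"
proof -
  define N where "N = DIM('a) + 2 * q"
  define I where "I L \<epsilon> = integral (parallel_body L \<epsilon>) (\<lambda>s. norm s ^ (2 * q))" for L :: "'a set" and \<epsilon>
  define \<delta> where "\<delta> n = 1 / real (Suc n)" for n
  have \<delta>0: "\<delta> n > 0" for n by (simp add: \<delta>_def)
  have \<delta>: "\<delta> \<longlonglongrightarrow> 0"
    using LIMSEQ_inverse_real_of_nat by (simp add: \<delta>_def[abs_def] inverse_eq_divide)
  have "\<exists>P. polytope P \<and> 0 \<in> P \<and> P \<subseteq> K \<and> K \<subseteq> parallel_body P (\<delta> n)" for n
    using inner_polytope_approximation[OF assms(1,2,4) \<delta>0] by metis
  then obtain P where P: "\<And>n. polytope (P n)" "\<And>n. 0 \<in> P n" "\<And>n. P n \<subseteq> K"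
    "\<And>n. K \<subseteq> parallel_body (P n) (\<delta> n)" by metis
  have cP: "compact (P n)" for n using P(1) by (rule polytope_imp_compact)
  have "\<exists>p :: real poly. degree p \<le> N \<and> (\<forall>i. coeff p i \<ge> 0) \<and> (\<forall>t>0. I (P n) t = poly p t)" for n
    unfolding I_def N_def using P by (intro polytope_parallel_body_integral)
  then obtain p :: "nat \<Rightarrow> real poly" where p: "\<And>n. degree (p n) \<le> N" "\<And>n i. coeff (p n) i \<ge> 0"
    "\<And>n t. t > 0 \<Longrightarrow> I (P n) t = poly (p n) t" by metis
  have lower: "poly (p n) \<epsilon> \<le> I K \<epsilon>" if "\<epsilon> > 0" for n \<epsilon>
    unfolding p(3)[OF that, symmetric] I_def using that cP assms(1) P(3)
    by (intro parallel_body_integral_mono parallel_body_mono) auto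
  \<comment> \<open>The inclusion of \<open>K\<close> in
    \<open>parallel_body (P n) (\<delta> n)\<close> costs an extra radius \<open>\<delta> n\<close>,
    so the polynomial is evaluated at a shifted point.\<close>
  have upper: "I K \<epsilon> \<le> poly (p n) (\<epsilon> + \<delta> n)" if "\<epsilon> > 0" for n \<epsilon>
  proof -
    have "I K \<epsilon> \<le> I (P n) (\<epsilon> + \<delta> n)"
      unfolding I_def using that cP assms(1) P(4) \<delta>0[of n]
      by (intro parallel_body_integral_mono parallel_body_add) auto
    then show ?thesis using p(3)[of "\<epsilon> + \<delta> n" n] that \<delta>0[of n] by simp
  qed
  \<comment> \<open>With nonnegative coefficients, each one is at most the value at 1, and that
    value is at most \<open>I K 1\<close> for every \<open>n\<close>.\<close>
  have "bounded (range (\<lambda>n. coeff (p n) i))" for i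
  proof (rule boundedI, clarify)
    fix n
    have "coeff (p n) i \<le> poly (p n) 1"
    proof (cases "i \<le> N")
      case True
      then show ?thesis
        using member_le_sum[of i "{..N}" "coeff (p n)"] p(2)
        by (simp add: poly_altdef_le[OF p(1)])
    next
      case False
      then have "coeff (p n) i = 0" using p(1)[of n] by (intro coeff_eq_0) simp
      then show ?thesis using p(2) by (simp add: poly_altdef_le[OF p(1)] sum_nonneg)
    qed
    also have "\<dots> \<le> I K 1" by (rule lower) simp
    finally show "norm (coeff (p n) i) \<le> I K 1" using p(2) by simp
  qed
  then obtain r l where r: "strict_mono r" and l: "\<And>i. i < Suc N \<Longrightarrow> (\<lambda>n. coeff (p (r n)) i) \<longlonglongrightarrow> l i"
    using finite_family_convergent_subsequence[of "\<lambda>n i. coeff (p n) i" "Suc N"] by blast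
  define p' where "p' = (\<Sum>i\<le>N. monom (l i) i)"
  have p': "poly p' x = (\<Sum>i\<le>N. l i * x ^ i)" for x by (simp add: p'_def poly_sum poly_monom)
  have l0: "l i \<ge> 0" if "i \<le> N" for i
    using l[of i] that p(2) by (intro LIMSEQ_le_const) auto
  \<comment> \<open>The evaluation point may vary with \<open>n\<close>, as the shifted argument in
    \<open>upper\<close> demands.\<close>
  have conv: "(\<lambda>n. poly (p (r n)) (x n)) \<longlonglongrightarrow> poly p' x0" if "x \<longlonglongrightarrow> x0" for x x0
    unfolding p' poly_altdef_le[OF p(1)] by (intro tendsto_intros that l) auto
  have pos: "I K \<epsilon> = poly p' \<epsilon>" if \<epsilon>: "\<epsilon> > 0" for \<epsilon>
  proof (rule antisym)
    have "(\<lambda>n. \<epsilon> + (\<delta> \<circ> r) n) \<longlonglongrightarrow> \<epsilon> + 0"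
      by (intro tendsto_intros LIMSEQ_subseq_LIMSEQ[OF \<delta> r])
    then have "(\<lambda>n. poly (p (r n)) (\<epsilon> + \<delta> (r n))) \<longlonglongrightarrow> poly p' \<epsilon>"
      by (intro conv) simp
    then show "I K \<epsilon> \<le> poly p' \<epsilon>"
      by (rule LIMSEQ_le_const) (use upper[OF \<epsilon>] in auto)
    show "poly p' \<epsilon> \<le> I K \<epsilon>"
      using conv[OF tendsto_const[of \<epsilon>]] by (rule LIMSEQ_le_const2) (use lower[OF \<epsilon>] in auto)
  qed
  \<comment> \<open>At radius 0 both sides are limits along \<open>\<delta> n\<close>, where
    \<open>pos\<close> already gives equality.\<close>
  have "(\<lambda>n. I K (\<delta> n)) \<longlonglongrightarrow> I K 0"
    unfolding I_def \<delta>_def using assms by (intro parallel_body_integral_tendsto_0)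
  moreover have "(\<lambda>n. I K (\<delta> n)) \<longlonglongrightarrow> poly p' 0"
    unfolding pos[OF \<delta>0] by (intro tendsto_poly \<delta>)
  ultimately have "I K 0 = poly p' 0" by (rule LIMSEQ_unique)
  then have "I K \<epsilon> = poly p' \<epsilon>" if "\<epsilon> \<ge> 0" for \<epsilon>
    using pos[of \<epsilon>] that by (cases "\<epsilon> = 0") auto
  moreover have "coeff p' i \<ge> 0" for i
    unfolding p'_def using l0 by (auto simp: coeff_sum intro!: sum_nonneg)
  ultimately show ?thesis unfolding I_def by blast
qed

end
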